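(* Let $n\ge 1$ and consider labeled chip-firing on the infinite binary tree (with a self-loop at the root) in which $2^n-1$ chips labeled $1,2,\dots,2^n-1$ are initially placed at the root. Then every terminal (stable) configuration reachable from this initial configuration has exactly one chip at each node of levels $1,\dots,n$ (i.e. at each node $1,2,\dots,2^n-1$) and no chips elsewhere. Moreover, for every node $i$ on a level $k$ with $1\le k\le n-1$, in such a terminal configuration the chip at node $2^{\,n-k}i$ is the smallest chip among all chips in the subtree rooted at $i$, and the chip at node $2^{\,n-k}(i+1)-1$ is the largest chip among all chips in the subtree rooted at $i$.
   Context: The infinite binary tree has nodes labeled by positive integers: node $1$ is the root, and node $i$ has left child $2i$, right child $2i+1$, and (for $i>1$) parent $\lfloor i/2\rfloor$. A self-loop is added at the root, so every node has exactly three incident edge-ends. The level of node $i$ is $\lfloor \log_2 i\rfloor+1$ (the root is on level $1$). The subtree rooted at $i$ consists of $i$ and all its descendants. Labeled chip-firing: chips carry distinct integer labels; a node holding at least $3$ chips may fire by choosing any $3$ of its chips and sending the smallest to its left child, the largest to its right child, and the middle one to its parent (if the root fires, the middle chip stays at the root via the self-loop). A configuration is terminal (stable) if every node holds at most $2$ chips. For a node $i$ on level $k<n$, the node $2^{n-k}i$ is its straight left descendant on level $n$ and $2^{n-k}(i+1)-1$ is its straight right descendant on level $n$. *)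

theory Defs
  imports Complex_Main
begin

text \<open>Nodes of the tree are the positive naturals; 0 is not a node. The root is its own parent,
  which encodes the self-loop.\<close>

definition left_child :: "nat \<Rightarrow> nat" where
  "left_child v = 2 * v"

definition right_child :: "nat \<Rightarrow> nat" where
  "right_child v = 2 * v + 1"

definition parent :: "nat \<Rightarrow> nat" where
  "parent v = (if v = 1 then 1 else v div 2)"

definition level :: "nat \<Rightarrow> nat" where
  "level v = nat \<lfloor>log 2 (real v)\<rfloor> + 1"

inductive_set subtree :: "nat \<Rightarrow> nat set" for i :: nat where
  root: "i \<in> subtree i"
| left: "j \<in> subtree i \<Longrightarrow> left_child j \<in> subtree i"
| right: "j \<in> subtree i \<Longrightarrow> right_child j \<in> subtree i"

text \<open>A configuration maps each node to the set of (labels of) chips it holds.\<close>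

type_synonym config = "nat \<Rightarrow> int set"

definition fire :: "config \<Rightarrow> nat \<Rightarrow> int \<Rightarrow> int \<Rightarrow> int \<Rightarrow> config" where
  "fire C v a b c = (\<lambda>w.
     (if w = v then C w - {a, b, c} else C w)
     \<union> (if w = left_child v then {a} else {})
     \<union> (if w = parent v then {b} else {})
     \<union> (if w = right_child v then {c} else {}))"

inductive fires :: "config \<Rightarrow> config \<Rightarrow> bool" where
  "\<lbrakk>v \<ge> 1; a \<in> C v; b \<in> C v; c \<in> C v; a < b; b < c\<rbrakk> \<Longrightarrow> fires C (fire C v a b c)"

definition reachable :: "config \<Rightarrow> config \<Rightarrow> bool" where
  "reachable C D \<longleftrightarrow> fires\<^sup>*\<^sup>* C D"

definition terminal :: "config \<Rightarrow> bool" where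
  "terminal C \<longleftrightarrow> (\<forall>v\<ge>1. finite (C v) \<and> card (C v) \<le> 2)"

definition initial :: "nat \<Rightarrow> config" where
  "initial n = (\<lambda>v. if v = 1 then {1..2 ^ n - 1} else {})"

definition subtree_chips :: "config \<Rightarrow> nat \<Rightarrow> int set" where
  "subtree_chips C i = (\<Union>v\<in>subtree i. C v)"

lemma levels_upto_eq: "{v. 1 \<le> v \<and> level v \<le> n} = {1..2 ^ n - 1}"
proof -
  have "level v \<le> n \<longleftrightarrow> v < 2 ^ n" if "1 \<le> v" for v
  proof -
    have "\<lfloor>log 2 (real v)\<rfloor> \<ge> 0" using that by simp
    then have "level v \<le> n \<longleftrightarrow> \<lfloor>log 2 (real v)\<rfloor> < int n"
      unfolding level_def by linarith
    also have "\<dots> \<longleftrightarrow> log 2 (real v) < real n"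
      by (simp add: floor_less_iff)
    also have "\<dots> \<longleftrightarrow> real v < 2 powr real n"
      using that by (simp add: log_less_iff)
    also have "\<dots> \<longleftrightarrow> real v < real (2 ^ n)"
      by (simp add: powr_realpow)
    finally show ?thesis by (simp only: of_nat_less_iff)
  qed
  then show ?thesis by (auto simp: less_eq_Suc_le)
qed

end

theory Submission
  imports Defs
begin

text \<open>
  The odometer (number of firings of each node) solves a discrete Poisson equation; the least action
  principle and the maximum principle identify it, and hence the final chip counts.

  Looking backwards in time, counting chips at a node just after its \<open>j\<close>-th last firing shows, by
  induction on \<open>j\<close> and then from the root downwards, that for nodes of level at most \<open>n - j\<close> this
  firing uses up all chips at the node and lies strictly between the \<open>(j + 1)\<close>-st and the \<open>j\<close>-th
  last firing of the parent.

  The minimum \<open>x\<close> of the final chips in the subtree of \<open>i\<close> is minimal in that subtree at all times, so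
  inside the subtree it can only move to the left. If \<open>i\<close> is a left child, \<open>x\<close> is also the minimum for
  the parent of \<open>i\<close>. If \<open>i\<close> is a right child, one of the last firings of the parent cannot bring in
  \<open>x\<close>: it sends the largest of exactly three chips to \<open>i\<close>, one of which \<open>i\<close> has just sent up and is
  therefore not minimal. So \<open>x\<close> arrives early enough to be carried along, by firings that leave no
  chip behind, down to level \<open>n\<close>.
\<close>

section \<open>Levels, children and subtrees\<close>

lemma level_le_iff:
  assumes "v \<ge> 1"
  shows "level v \<le> n \<longleftrightarrow> v < 2 ^ n"
proof -
  have "v \<in> {v. 1 \<le> v \<and> level v \<le> n} \<longleftrightarrow> v \<in> {1..2 ^ n - 1}"
    by (simp only: levels_upto_eq)
  moreover have "v \<le> 2 ^ n - 1 \<longleftrightarrow> v < 2 ^ n"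
    using zero_less_power[of "2::nat" n] by linarith
  ultimately show ?thesis using assms by simp
qed

text \<open>A Boolean side lets one proof serve both children, and later both the minimum and the
  maximum.\<close>

definition child :: "bool \<Rightarrow> nat \<Rightarrow> nat" where
  "child d v = (if d then right_child v else left_child v)"

lemma child_eq: "child d v = 2 * v + of_bool d"
  by (simp add: child_def left_child_def right_child_def)

lemma level_ge_1: "level v \<ge> 1"
  by (simp add: level_def)

lemma level_1: "level 1 = 1"
  by (simp add: level_def)

lemma level_child:
  assumes "v \<ge> 1"
  shows "level (child d v) = Suc (level v)"
proof -
  have iff: "level (child d v) \<le> Suc m \<longleftrightarrow> level v \<le> m" for m
  proof -
    have "level (child d v) \<le> Suc m \<longleftrightarrow> child d v < 2 ^ Suc m"
      using assms by (intro level_le_iff) (simp add: child_eq)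
    also have "\<dots> \<longleftrightarrow> v < 2 ^ m"
      by (cases d) (auto simp: child_eq)
    finally show ?thesis using assms by (simp add: level_le_iff)
  qed
  obtain m where m: "level (child d v) = Suc m"
    using level_ge_1[of "child d v"] by (cases "level (child d v)") auto
  have "level v \<le> m" using iff[of m] m by simp
  moreover have "m \<le> level v" using iff[of "level v"] m by simp
  ultimately show ?thesis using m by simp
qed

lemma child_cases:
  assumes "v \<ge> 2"
  obtains d where "v = child d (parent v)" "parent v \<ge> 1" "parent v < v"
proof
  show "v = child (odd v) (parent v)" using assms by (auto simp: child_eq parent_def)
  show "parent v \<ge> 1" "parent v < v" using assms by (auto simp: parent_def)
qed

lemma parent_child [simp]: "v \<ge> 1 \<Longrightarrow> parent (child d v) = v"
  by (auto simp: parent_def child_eq)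

lemma child_ne [simp]: "v \<ge> 1 \<Longrightarrow> child d v \<noteq> v" "v \<ge> 1 \<Longrightarrow> v \<noteq> child d v"
  by (auto simp: child_eq)

lemma child_eq_iff: "child d v = child e w \<longleftrightarrow> d = e \<and> v = w"
  by (cases d; cases e) (simp_all add: child_eq, presburger+)

lemma child_ne_1: "v \<ge> 1 \<Longrightarrow> child d v \<noteq> 1"
  by (auto simp: child_eq)

lemma level_parent: "v \<ge> 2 \<Longrightarrow> level v = Suc (level (parent v))"
  by (metis child_cases level_child)

lemma subtree_child: "v \<in> subtree i \<Longrightarrow> child d v \<in> subtree i"
  by (auto simp: child_def intro: subtree.intros)

lemma child_in_subtreeD:
  assumes "child d v \<in> subtree i"
  shows "child d v = i \<or> v \<in> subtree i"
  using assms
proof (cases rule: subtree.cases)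
  case (left j)
  then show ?thesis by (cases d) (auto simp: child_eq left_child_def, presburger)
next
  case (right j)
  then show ?thesis by (cases d) (auto simp: child_eq right_child_def, presburger)
qed auto

lemma subtree_ge: "v \<in> subtree i \<Longrightarrow> i \<le> v"
  by (induction rule: subtree.induct) (auto simp: left_child_def right_child_def)

lemma subtree_trans: "v \<in> subtree j \<Longrightarrow> j \<in> subtree i \<Longrightarrow> v \<in> subtree i"
  by (induction rule: subtree.induct) (auto intro: subtree.intros)

section \<open>Effect of a single firing on chip sets and chip counts\<close>

definition valid_config :: "config \<Rightarrow> bool" where
  "valid_config C \<longleftrightarrow> (\<forall>v. finite (C v)) \<and> (\<forall>u v x. x \<in> C u \<longrightarrow> x \<in> C v \<longrightarrow> u = v) \<and> C 0 = {}"

lemma in_fire_iff: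
  "x \<in> fire C v a b c w \<longleftrightarrow> x \<in> C w \<and> (w = v \<longrightarrow> x \<notin> {a, b, c})
     \<or> w = child False v \<and> x = a \<or> w = parent v \<and> x = b \<or> w = child True v \<and> x = c"
  by (auto simp: fire_def child_def)

lemma valid_config_fire:
  assumes "valid_config C" "v \<ge> 1" "a \<in> C v" "b \<in> C v" "c \<in> C v" "a < b" "b < c"
  shows "valid_config (fire C v a b c)"
proof -
  have "finite (fire C v a b c w)" for w
    using assms(1) by (auto simp: valid_config_def fire_def)
  moreover have "u = w" if "x \<in> fire C v a b c u" "x \<in> fire C v a b c w" for u w x
    using that assms unfolding in_fire_iff valid_config_def by (elim disjE) (auto; blast)+
  moreover have "fire C v a b c 0 = {}"
    using assms by (auto simp: valid_config_def fire_def left_child_def right_child_def parent_def)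
  ultimately show ?thesis by (auto simp: valid_config_def)
qed

text \<open>The count is read from the receiving node \<open>w\<close>. At the root
  \<open>parent w = w\<close>, so the last summand is the self-loop and a firing costs the root only
  two chips.\<close>

lemma card_fire:
  assumes C: "valid_config C" and "v \<ge> 1" "a \<in> C v" "b \<in> C v" "c \<in> C v" "a < b" "b < c"
    and "w \<ge> 1"
  shows "int (card (fire C v a b c w)) = int (card (C w)) - 3 * of_bool (v = w)
    + of_bool (v = child False w) + of_bool (v = child True w) + of_bool (v = parent w)"
proof (cases "w = v")
  case True
  have fin: "finite (C v)" using C by (simp add: valid_config_def)
  have "card {a, b, c} \<le> card (C v)" using assms fin by (intro card_mono) auto
  then have three: "card (C v - {a, b, c}) + 3 = card (C v)"
    using assms fin by (subst card_Diff_subset) auto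
  show ?thesis
  proof (cases "v = 1")
    case True
    then have "fire C v a b c w = insert b (C v - {a, b, c})"
      using \<open>w = v\<close> by (auto simp: fire_def left_child_def right_child_def parent_def)
    then show ?thesis using three \<open>w = v\<close> True fin by (simp add: child_eq parent_def)
  next
    case False
    then have "fire C v a b c w = C v - {a, b, c}"
      using \<open>w = v\<close> \<open>v \<ge> 1\<close> by (auto simp: fire_def left_child_def right_child_def parent_def)
    then show ?thesis using three \<open>w = v\<close> False \<open>v \<ge> 1\<close> by (auto simp: child_eq parent_def)
  qed
next
  case False
  then have notin: "a \<notin> C w" "b \<notin> C w" "c \<notin> C w" and fin: "finite (C w)"
    using C assms by (auto simp: valid_config_def)
  consider (l) "w = child False v" | (r) "w = child True v" | (p) "w = parent v"
    | (none) "w \<noteq> child False v" "w \<noteq> child True v" "w \<noteq> parent v" by blast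
  then show ?thesis
  proof cases
    case l
    then have "fire C v a b c w = insert a (C w)"
      using \<open>v \<ge> 1\<close> by (auto simp: fire_def left_child_def right_child_def parent_def child_eq)
    then show ?thesis using notin fin l \<open>v \<ge> 1\<close> by (auto simp: child_eq parent_def)
  next
    case r
    then have "fire C v a b c w = insert c (C w)"
      using \<open>v \<ge> 1\<close> by (auto simp: fire_def left_child_def right_child_def parent_def child_eq)
    then show ?thesis using notin fin r \<open>v \<ge> 1\<close> by (auto simp: child_eq parent_def)
  next
    case p
    then have v2: "v \<ge> 2" using False \<open>v \<ge> 1\<close> by (cases "v = 1") (auto simp: parent_def)
    then have "fire C v a b c w = insert b (C w)"
      using p by (auto simp: fire_def left_child_def right_child_def parent_def)
    moreover have "v \<noteq> w" "v \<noteq> parent w" using v2 p False by (auto simp: parent_def)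
    moreover have "of_bool (v = child False w) + of_bool (v = child True w) = (1 :: int)"
      using v2 p by (auto simp: child_eq parent_def)
    ultimately show ?thesis using notin fin by simp
  next
    case none
    then have "fire C v a b c w = C w"
      using False by (auto simp: fire_def child_def)
    moreover have "v \<noteq> child False w" "v \<noteq> child True w" "v \<noteq> parent w"
      using none False \<open>w \<ge> 1\<close> by (auto simp: parent_def child_eq split: if_splits)
    ultimately show ?thesis using False by simp
  qed
qed

section \<open>Timed runs and firing counts\<close>

locale stabilizing_run =
  fixes n N :: nat and C :: "nat \<Rightarrow> config" and site :: "nat \<Rightarrow> nat" and lo mid hi :: "nat \<Rightarrow> int"
  assumes n_pos: "n \<ge> 1"
    and start: "C 0 = initial n"
    and step: "t < N \<Longrightarrow> C (Suc t) = fire (C t) (site t) (lo t) (mid t) (hi t)"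
    and site_ge: "t < N \<Longrightarrow> site t \<ge> 1"
    and chips_in: "t < N \<Longrightarrow> {lo t, mid t, hi t} \<subseteq> C t (site t)"
    and chips_less: "t < N \<Longrightarrow> lo t < mid t" "t < N \<Longrightarrow> mid t < hi t"
    and final: "terminal (C N)"
begin

text \<open>Half-open, since the firing at time \<open>t\<close> leads from \<open>C t\<close> to
  \<open>C (Suc t)\<close>. Hence \<open>site s = v\<close> and
  \<open>remaining (Suc s) v = j\<close> single out the \<open>(j + 1)\<close>-st last firing of
  \<open>v\<close>.\<close>

definition firings :: "nat \<Rightarrow> nat \<Rightarrow> nat \<Rightarrow> nat" where
  "firings s t v = (\<Sum>r = s..<t. of_bool (site r = v))"

abbreviation remaining :: "nat \<Rightarrow> nat \<Rightarrow> nat" where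
  "remaining t v \<equiv> firings t N v"

lemma firings_refl [simp]: "firings t t v = 0"
  by (simp add: firings_def)

lemma firings_Suc: "s \<le> t \<Longrightarrow> firings s (Suc t) v = firings s t v + of_bool (site t = v)"
  by (simp add: firings_def)

lemma firings_split: "s \<le> t \<Longrightarrow> t \<le> r \<Longrightarrow> firings s r v = firings s t v + firings t r v"
  unfolding firings_def by (rule sum.atLeastLessThan_concat[symmetric])

lemma remaining_step: "t < N \<Longrightarrow> remaining t v = of_bool (site t = v) + remaining (Suc t) v"
  using firings_split[of t "Suc t" N v] firings_Suc[of t t v] by simp

lemma remaining_antimono: "s \<le> t \<Longrightarrow> t \<le> N \<Longrightarrow> remaining t v \<le> remaining s v"
  using firings_split[of s t N v] by simp

text \<open>\<open>remaining\<close> drops by at most one per step and ends at 0, so it reaches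
  \<open>m\<close> through some firing of \<open>v\<close>.\<close>

lemma obtain_firing:
  assumes "m < remaining 0 v"
  obtains s where "s < N" "site s = v" "remaining (Suc s) v = m"
proof -
  have "\<exists>k<N. (\<forall>i\<le>k. \<not> remaining i v \<le> m) \<and> remaining (Suc k) v \<le> m"
    using assms by (intro ex_least_nat_less) auto
  then obtain k where k: "k < N" "\<not> remaining k v \<le> m" "remaining (Suc k) v \<le> m" by auto
  then have "site k = v" "remaining (Suc k) v = m"
    using remaining_step[of k v] by (cases "site k = v"; simp)+
  then show ?thesis using k that by blast
qed

lemma valid: "t \<le> N \<Longrightarrow> valid_config (C t)"
proof (induction t)
  case 0
  then show ?case by (auto simp: start valid_config_def initial_def)
next
  case (Suc t)
  then show ?case
    using valid_config_fire[of "C t"] step[of t] site_ge[of t] chips_in[of t] chips_less[of t] by auto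
qed

lemma labels: "t \<le> N \<Longrightarrow> C t v \<subseteq> {1..2 ^ n - 1}"
proof (induction t arbitrary: v)
  case 0
  then show ?case by (auto simp: start initial_def)
next
  case (Suc t)
  have "C (Suc t) v \<subseteq> C t v \<union> C t (site t)"
    using step[of t] chips_in[of t] Suc.prems by (auto simp: in_fire_iff)
  moreover have "C t w \<subseteq> {1..2 ^ n - 1}" for w
    using Suc by simp
  ultimately show ?case by blast
qed

lemma card_step:
  assumes "t < N" "v \<ge> 1"
  shows "int (card (C (Suc t) v)) = int (card (C t v)) - 3 * of_bool (site t = v)
    + of_bool (site t = child False v) + of_bool (site t = child True v) + of_bool (site t = parent v)"
  using card_fire[of "C t" "site t" "lo t" "mid t" "hi t" v] assms valid[of t] step[of t]
    site_ge[of t] chips_in[of t] chips_less[of t] by simp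

lemma card_balance:
  assumes "s \<le> t" "t \<le> N" "v \<ge> 1"
  shows "int (card (C t v)) = int (card (C s v)) - 3 * int (firings s t v)
    + int (firings s t (child False v)) + int (firings s t (child True v))
    + int (firings s t (parent v))"
  using assms
proof (induction t rule: dec_induct)
  case (step t)
  then show ?case using card_step[of t v] by (simp add: firings_Suc algebra_simps)
qed simp

subsection \<open>Odometer and final chip counts\<close>

text \<open>Level by level solution of the discrete Poisson equation whose right-hand side turns the
  initial chip counts into one chip per node of level at most \<open>n\<close>.\<close>

definition expected :: "nat \<Rightarrow> int" where
  "expected v = (if v \<ge> 1 \<and> level v \<le> n
     then 2 ^ Suc (n - level v) - 2 - int (n - level v) else 0)"

lemma card_initial: "int (card (initial n v)) = (if v = 1 then 2 ^ n - 1 else 0)"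
proof -
  have "int (nat (2 ^ n - 1)) = 2 ^ n - (1::int)" by (subst int_nat_eq) simp
  then show ?thesis by (auto simp: initial_def)
qed

text \<open>Put e = \<open>n - level v\<close> and f(e) = 2^(e+1) - 2 - e. Then f(e+1) - 3 f(e) + 2
  f(e-1) = 1, and f(0) = f(-1) = 0 fits the extension by zero below level \<open>n\<close>. At the
  root the self-loop puts f(n-1) in place of f(n); the difference 2^n - 1 is the number of initial
  chips.\<close>

lemma expected_Poisson:
  assumes "v \<ge> 1"
  shows "int (card (initial n v)) - 3 * expected v + expected (child False v)
    + expected (child True v) + expected (parent v) = of_bool (level v \<le> n)"
proof -
  have ch: "expected (child d v) = (if level v < n
      then 2 ^ (n - level v) - 1 - int (n - level v) else 0)" for d
  proof (cases "level v < n")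
    case True
    then obtain e where "n - level v = Suc e" "n - Suc (level v) = e"
      by (metis Suc_diff_Suc)
    moreover have "child d v \<ge> 1" using assms by (simp add: child_eq)
    ultimately show ?thesis using True assms by (simp add: expected_def level_child)
  qed (use assms in \<open>simp add: expected_def level_child\<close>)
  show ?thesis
  proof (cases "v = 1")
    case True
    obtain e where e: "n = Suc e" using n_pos by (cases n) auto
    have "expected 1 = 2 ^ n - 1 - int n"
      unfolding expected_def level_1 using e by simp
    then show ?thesis
      unfolding ch card_initial using True e level_1
      by (cases e) (simp_all add: parent_def)
  next
    case False
    then have v2: "v \<ge> 2" using assms by simp
    then have p: "parent v \<ge> 1" "level v = Suc (level (parent v))"
      using level_parent by (auto simp: parent_def)
    consider "level v < n" | "level v = n" | "level v > n" by linarith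
    then show ?thesis
    proof cases
      case 1
      then have "n - level (parent v) = Suc (n - level v)" using p by simp
      then show ?thesis unfolding ch card_initial using 1 p False assms
        by (simp add: expected_def)
    next
      case 2
      then have "n - level (parent v) = 1" using p by simp
      then show ?thesis unfolding ch card_initial using 2 p False assms
        by (simp add: expected_def)
    next
      case 3
      then show ?thesis unfolding ch card_initial using p False assms
        by (auto simp: expected_def le_Suc_eq)
    qed
  qed
qed

lemma expected_nonneg: "expected v \<ge> 0"
proof -
  have "2 + int d \<le> 2 ^ Suc d" for d by (induction d) auto
  from this[of "n - level v"] show ?thesis unfolding expected_def by simp linarith
qed

text \<open>Least action principle: a node that has already fired the expected number of times
  holds at most one chip as long as no other node has exceeded its quota.\<close>

lemma firings_le_expected:
  assumes "t \<le> N" "v \<ge> 1"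
  shows "int (firings 0 t v) \<le> expected v"
  using assms
proof (induction t arbitrary: v)
  case 0
  then show ?case by (simp add: expected_nonneg)
next
  case (Suc t)
  show ?case
  proof (cases "site t = v \<and> int (firings 0 t v) = expected v")
    case True
    have "parent v \<ge> 1" using Suc.prems by (auto simp: parent_def)
    then have "int (firings 0 t (child False v)) \<le> expected (child False v)"
      "int (firings 0 t (child True v)) \<le> expected (child True v)"
      "int (firings 0 t (parent v)) \<le> expected (parent v)"
      using Suc by (auto simp: child_eq)
    then have "int (card (C t v)) \<le> of_bool (level v \<le> n)"
      using card_balance[of 0 t v] expected_Poisson[of v] Suc.prems True
      by (simp add: start)
    moreover have "card {lo t, mid t, hi t} \<le> card (C t v)"
      using True chips_in[of t] valid[of t] Suc.prems
      by (intro card_mono) (auto simp: valid_config_def)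
    moreover have "card {lo t, mid t, hi t} = 3"
      using chips_less[of t] Suc.prems by simp
    ultimately show ?thesis by (cases "level v \<le> n") simp_all
  next
    case False
    then show ?thesis using Suc.IH[of v] Suc.prems by (auto simp: firings_Suc)
  qed
qed

text \<open>Maximum principle: at the deepest node maximising the deficit, both children have a smaller
  deficit, so that node would have to end with at least three chips.\<close>

lemma firings_eq_expected:
  assumes "v \<ge> 1"
  shows "int (firings 0 N v) = expected v"
proof (rule ccontr)
  define w where "w u = expected u - int (firings 0 N u)" for u
  assume "int (firings 0 N v) \<noteq> expected v"
  then have wv: "w v > 0" using firings_le_expected[of N v] assms by (simp add: w_def)
  have w_out: "w u \<le> 0" if "u \<ge> 2 ^ n" for u
  proof -
    have "\<not> level u \<le> n" if "u \<ge> 1" using level_le_iff[of u n] that \<open>u \<ge> 2 ^ n\<close> by simp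
    then show ?thesis by (auto simp: w_def expected_def)
  qed
  define A where "A = {1..<(2::nat) ^ n}"
  have vA: "v \<in> A" using wv w_out[of v] \<open>v \<ge> 1\<close> by (force simp: A_def)
  define m where "m = Max (w ` A)"
  have le_m: "w u \<le> m" if "u \<in> A" for u using that by (simp add: m_def A_def)
  have mpos: "m > 0" using le_m[OF vA] wv by simp
  define M where "M = {u \<in> A. w u = m}"
  have "m \<in> w ` A" unfolding m_def using vA by (intro Max_in) (auto simp: A_def)
  then have M: "finite M" "M \<noteq> {}" by (auto simp: M_def A_def)
  \<comment> \<open>Children have larger numbers, so the largest maximiser serves as the deepest
    one.\<close>
  define x where "x = Max M"
  have x: "x \<in> A" "w x = m" using Max_in[OF M] by (auto simp: M_def x_def)
  have x1: "x \<ge> 1" using x by (simp add: A_def)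
  have lev: "level x \<le> n" using x x1 by (simp add: A_def level_le_iff)
  have big: "w u < m" if "u > x" for u
  proof (cases "u \<in> A")
    case True
    then have "u \<notin> M" using Max_ge[OF M(1), of u] that by (auto simp: x_def)
    then show ?thesis using True le_m[of u] by (auto simp: M_def)
  next
    case False
    then show ?thesis using w_out[of u] mpos that x1 by (auto simp: A_def)
  qed
  have "w (child d x) < m" for d using x1 by (intro big) (simp add: child_eq)
  then have "w (child False x) < m" "w (child True x) < m" by auto
  moreover have "w (parent x) \<le> m" using x1 x by (intro le_m) (auto simp: A_def parent_def)
  moreover have "int (card (C N x)) \<le> 2" using final x1 by (auto simp: terminal_def)
  ultimately show False
    using card_balance[of 0 N x] expected_Poisson[OF x1] lev x x1 by (simp add: start w_def)
qed

lemma final_card: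
  assumes "v \<ge> 1"
  shows "card (C N v) = of_bool (level v \<le> n)"
proof -
  have "parent v \<ge> 1" using assms by (auto simp: parent_def)
  then have "int (card (C N v)) = of_bool (level v \<le> n)"
    using card_balance[of 0 N v] expected_Poisson[of v]
      firings_eq_expected[of v] firings_eq_expected[of "parent v"]
      firings_eq_expected[of "child False v"] firings_eq_expected[of "child True v"]
      assms by (simp add: start child_eq)
  then show ?thesis by (cases "level v \<le> n") simp_all
qed

text \<open>Guarantees that the late firings considered below exist; it rests on 2^(e+1) - 2 - e >=
  e for e = \<open>n - level v\<close>.\<close>

lemma remaining_ge:
  assumes "v \<ge> 1"
  shows "n - level v \<le> remaining 0 v"
proof (cases "level v \<le> n")
  case True
  have "2 + 2 * int d \<le> 2 ^ Suc d" for d by (induction d) auto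
  from this[of "n - level v"] show ?thesis
    using firings_eq_expected[OF assms] True assms by (simp add: expected_def)
qed simp

subsection \<open>The last firings of a node\<close>

text \<open>Counts encode temporal order: \<open>Suc j\<close> firings left at the parent put its
  \<open>(j + 1)\<close>-st last firing after that of \<open>v\<close>. The root is exempt, being
  its own parent.\<close>

definition tight :: "nat \<Rightarrow> nat \<Rightarrow> bool" where
  "tight j v \<longleftrightarrow> (\<forall>s<N. site s = v \<longrightarrow> remaining (Suc s) v = j \<longrightarrow>
     (\<forall>d. remaining (Suc s) (child d v) = j) \<and>
     (v \<noteq> 1 \<longrightarrow> remaining (Suc s) (parent v) = Suc j) \<and>
     C s v = {lo s, mid s, hi s})"

lemma tightD:
  assumes "tight j v" "s < N" "site s = v" "remaining (Suc s) v = j"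
  shows "remaining (Suc s) (child d v) = j"
    and "v \<noteq> 1 \<Longrightarrow> remaining (Suc s) (parent v) = Suc j"
    and "C s v = {lo s, mid s, hi s}"
  using assms unfolding tight_def by blast+

lemma remaining_less_imp_le:
  assumes "remaining (Suc r) v < remaining s v" "s \<le> N" "r < N"
  shows "s \<le> r"
  using assms remaining_antimono[of "Suc r" s v] by fastforce

text \<open>Tightness of the neighbours bounds their remaining firings from below by j, j and j + 1.
  The chip balance from \<open>Suc s\<close> to the end makes their sum plus the chips left at
  \<open>v\<close> equal to 3 j + 1, so every bound is attained and nothing is left at
  \<open>v\<close>.\<close>

lemma tight_step:
  assumes v: "v \<ge> 1" "level v + j < n"
    and children: "\<And>d. j > 0 \<Longrightarrow> tight (j - 1) (child d v)"
    and par: "v \<noteq> 1 \<Longrightarrow> tight j (parent v)"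
  shows "tight j v"
  unfolding tight_def
proof (intro allI impI)
  fix s
  assume s: "s < N" "site s = v" "remaining (Suc s) v = j"
  have rem_s: "remaining s v = Suc j" using remaining_step[of s v] s by simp
  \<comment> \<open>The child's \<open>j\<close>-th last firing happens when \<open>v\<close> has
    only \<open>j\<close> firings left, hence after \<open>s\<close>.\<close>
  have ch: "remaining (Suc s) (child d v) \<ge> j" for d
  proof (cases "j > 0")
    case True
    have "child d v \<ge> 1" using v by (simp add: child_eq)
    then have "j - 1 < remaining 0 (child d v)"
      using remaining_ge[of "child d v"] level_child[of v d] v True by simp
    then obtain r where r: "r < N" "site r = child d v" "remaining (Suc r) (child d v) = j - 1"
      by (rule obtain_firing)
    have "remaining (Suc r) v = j"
      using tightD(2)[OF children[OF True] r child_ne_1[OF v(1)]] v True by simp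
    then have "s \<le> r" using remaining_less_imp_le[of r v s] rem_s s r by simp
    moreover have "s \<noteq> r" using s r v by auto
    ultimately have "remaining r (child d v) \<le> remaining (Suc s) (child d v)"
      using remaining_antimono[of "Suc s" r] r by simp
    then show ?thesis using remaining_step[of r "child d v"] r True by simp
  qed simp
  \<comment> \<open>The parent's \<open>(j + 1)\<close>-st last firing likewise leaves
    \<open>v\<close> with only \<open>j\<close> firings, so it comes after \<open>s\<close>.\<close>
  have pa: "remaining (Suc s) (parent v) \<ge> Suc j" if "v \<noteq> 1"
  proof -
    obtain d where p: "v = child d (parent v)" "parent v \<ge> 1" "parent v < v"
      using child_cases[of v] v \<open>v \<noteq> 1\<close> by auto
    have "j < remaining 0 (parent v)"
      using remaining_ge[of "parent v"] level_child[of "parent v" d] p v by simp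
    then obtain r where r: "r < N" "site r = parent v" "remaining (Suc r) (parent v) = j"
      by (rule obtain_firing)
    have "remaining (Suc r) v = j"
      using tightD(1)[OF par[OF that] r, of d] p by simp
    then have "s \<le> r" using remaining_less_imp_le[of r v s] rem_s s r by simp
    moreover have "s \<noteq> r" using s r p by auto
    ultimately have "remaining r (parent v) \<le> remaining (Suc s) (parent v)"
      using remaining_antimono[of "Suc s" r] r by simp
    then show ?thesis using remaining_step[of r "parent v"] r by simp
  qed
  have "level v \<le> n" using v by simp
  then have bal: "int (card (C (Suc s) v)) + int (remaining (Suc s) (child False v))
      + int (remaining (Suc s) (child True v)) + int (remaining (Suc s) (parent v)) = 1 + 3 * int j"
    using card_balance[of "Suc s" N v] final_card[of v] s v by simp
  have fin: "finite (C (Suc s) v)" using valid[of "Suc s"] s by (simp add: valid_config_def)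
  have rest: "C s v - {lo s, mid s, hi s} \<subseteq> C (Suc s) v"
    using step[of s] s by (auto simp: in_fire_iff)
  have sub: "{lo s, mid s, hi s} \<subseteq> C s v" using chips_in[of s] s by simp
  show "(\<forall>d. remaining (Suc s) (child d v) = j) \<and>
     (v \<noteq> 1 \<longrightarrow> remaining (Suc s) (parent v) = Suc j) \<and>
     C s v = {lo s, mid s, hi s}"
  proof (cases "v = 1")
    \<comment> \<open>At the root the parent term is only j; the middle chip, returned by the
      self-loop, makes up for the missing 1.\<close>
    case True
    then have pv: "parent v = v" by (simp add: parent_def)
    then have "mid s \<in> C (Suc s) v" using step[of s] s by (simp add: in_fire_iff)
    then have "card (C (Suc s) v) \<noteq> 0" using fin by auto
    then have "card (C (Suc s) v) = 1" "remaining (Suc s) (child False v) = j"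
      "remaining (Suc s) (child True v) = j"
      using bal ch[of False] ch[of True] s(3) unfolding pv by linarith+
    moreover from this have "C (Suc s) v = {mid s}"
      using \<open>mid s \<in> C (Suc s) v\<close> by (auto simp: card_1_singleton_iff)
    ultimately show ?thesis using rest sub True by (auto simp: all_bool_eq)
  next
    case False
    then have "card (C (Suc s) v) = 0" "remaining (Suc s) (child False v) = j"
      "remaining (Suc s) (child True v) = j" "remaining (Suc s) (parent v) = Suc j"
      using bal ch[of False] ch[of True] pa by linarith+
    moreover from this have "C (Suc s) v = {}" using fin by simp
    ultimately show ?thesis using rest sub by (auto simp: all_bool_eq)
  qed
qed

text \<open>The outer induction serves the children, the inner one the parent. The level bound
  survives because a child, one level deeper, is used with \<open>j - 1\<close>.\<close>

lemma tight: "v \<ge> 1 \<Longrightarrow> level v + j < n \<Longrightarrow> tight j v"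
proof (induction j arbitrary: v rule: less_induct)
  case outer: (less j)
  from outer.prems show ?case
  proof (induction v rule: less_induct)
    case (less v)
    show ?case
    proof (rule tight_step)
      fix d
      assume "j > 0"
      then show "tight (j - 1) (child d v)"
        using outer.IH[of "j - 1" "child d v"] less.prems level_child[of v d] by (simp add: child_eq)
    next
      assume "v \<noteq> 1"
      then obtain d where "v = child d (parent v)" "parent v \<ge> 1" "parent v < v"
        using child_cases[of v] less.prems by auto
      then show "tight j (parent v)"
        using less.IH[of "parent v"] less.prems level_child[of "parent v" d] by simp
    qed (use less.prems in auto)
  qed
qed

subsection \<open>Extreme chips of a subtree\<close>

text \<open>The smallest and the largest chip are treated together: \<open>d\<close> is the side (\<^const>\<open>True\<close> for
  right) and \<open>orient d\<close> the sign under which the chips sent to that side are minimal.\<close>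

definition sent :: "bool \<Rightarrow> nat \<Rightarrow> int" where
  "sent d t = (if d then hi t else lo t)"

definition orient :: "bool \<Rightarrow> int" where
  "orient d = (if d then - 1 else 1)"

lemma fired_chips_eq: "{lo t, mid t, hi t} = {sent d t, mid t, sent (\<not> d) t}"
  by (auto simp: sent_def)

lemma orient_sent:
  assumes "t < N"
  shows "orient d * sent d t < orient d * mid t" "orient d * mid t < orient d * sent (\<not> d) t"
  using chips_less[OF assms] by (auto simp: orient_def sent_def)

lemma in_step_iff:
  assumes "t < N"
  shows "x \<in> C (Suc t) w \<longleftrightarrow> x \<in> C t w \<and> (w = site t \<longrightarrow> x \<notin> {lo t, mid t, hi t})
     \<or> w = parent (site t) \<and> x = mid t \<or> (\<exists>d. w = child d (site t) \<and> x = sent d t)"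
  unfolding step[OF assms] in_fire_iff by (auto simp: sent_def ex_bool_eq)

lemma stays:
  assumes "t \<le> s" "s \<le> N" "firings t s w = 0" "x \<in> C t w"
  shows "x \<in> C s w"
  using assms
proof (induction s rule: dec_induct)
  case (step s)
  then have "firings t s w = 0" "site s \<noteq> w" by (auto simp: firings_Suc split: if_splits)
  then show ?case using step in_step_iff[of s x w] by auto
qed simp

lemma sent_in_subtree:
  assumes "t < N" "site t \<in> subtree i"
  shows "sent d t \<in> subtree_chips (C (Suc t)) i"
proof -
  have "sent d t \<in> C (Suc t) (child d (site t))" using in_step_iff assms by blast
  then show ?thesis using subtree_child[OF assms(2)] by (auto simp: subtree_chips_def)
qed

text \<open>If \<open>y\<close> itself is fired, the chip sent to side \<open>d\<close> is at least
  as extreme and lands on a child, hence stays in the subtree.\<close>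

lemma subtree_min_step:
  assumes "t < N" "i \<ge> 1" "y \<in> subtree_chips (C t) i"
  shows "\<exists>z\<in>subtree_chips (C (Suc t)) i. orient d * z \<le> orient d * y"
proof -
  obtain w where w: "w \<in> subtree i" "y \<in> C t w" using assms by (auto simp: subtree_chips_def)
  show ?thesis
  proof (cases "site t = w \<and> y \<in> {lo t, mid t, hi t}")
    case False
    then have "y \<in> C (Suc t) w" using in_step_iff[of t y w] w assms by blast
    then show ?thesis using w by (auto simp: subtree_chips_def)
  next
    case True
    then have "orient d * sent d t \<le> orient d * y"
      using orient_sent[OF assms(1), of d] fired_chips_eq[of t d] by auto
    then show ?thesis using sent_in_subtree[of t i d] True w assms by blast
  qed
qed

text \<open>A node never sends up the minimum of the chips it fires, so the minimum over a subtree
  cannot increase with time.\<close>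

lemma final_min_le:
  assumes "t \<le> N" "i \<ge> 1" "\<And>z. z \<in> subtree_chips (C N) i \<Longrightarrow> orient d * x \<le> orient d * z"
    and "y \<in> subtree_chips (C t) i"
  shows "orient d * x \<le> orient d * y"
  using assms(1,4)
proof (induction t arbitrary: y rule: inc_induct)
  case (step t)
  then show ?case using subtree_min_step[of t i y d] assms(2) by (meson order_trans)
qed (use assms(3) in blast)

context
  fixes i :: nat and d :: bool and x :: int
  assumes i: "i \<ge> 1"
    and minimal: "\<forall>t\<le>N. \<forall>y\<in>subtree_chips (C t) i. orient d * x \<le> orient d * y"
begin

text \<open>The chip sent to side \<open>d\<close> is in the subtree before the firing, so
  minimality leaves \<open>x\<close> no other role.\<close>

lemma min_sent:
  assumes "t < N" "site t \<in> subtree i" "x \<in> {lo t, mid t, hi t}"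
  shows "x = sent d t" "x \<in> C (Suc t) (child d (site t))"
proof -
  have "sent d t \<in> C t (site t)" using chips_in[OF assms(1)] by (auto simp: sent_def)
  then have "sent d t \<in> subtree_chips (C t) i"
    using assms by (auto simp: subtree_chips_def)
  then have "orient d * x \<le> orient d * sent d t"
    using minimal less_imp_le[OF assms(1)] by blast
  then show "x = sent d t"
    using orient_sent[OF assms(1), of d] assms(3) fired_chips_eq[of t d] by auto
  then show "x \<in> C (Suc t) (child d (site t))" using in_step_iff[OF assms(1)] by blast
qed

lemma min_leaves:
  assumes "t \<le> s" "s < N" "x \<in> C t w" "w \<in> subtree i"
  shows "x \<in> C s w \<or> (\<exists>r<s. site r = w \<and> x \<in> C (Suc r) (child d w))"
  using assms
proof (induction s rule: dec_induct)
  case (step s)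
  then consider (here) "x \<in> C s w" | (gone) "\<exists>r<s. site r = w \<and> x \<in> C (Suc r) (child d w)"
    by auto
  then show ?case
  proof cases
    case here
    show ?thesis
    proof (cases "site s = w \<and> x \<in> {lo s, mid s, hi s}")
      case True
      then have "x \<in> C (Suc s) (child d w)" using min_sent[of s] step by auto
      then show ?thesis using True by blast
    next
      case False
      then show ?thesis using in_step_iff[of s x w] here step by auto
    qed
  next
    case gone
    then show ?thesis using less_Suc_eq by blast
  qed
qed simp

text \<open>By tightness the firing at \<open>s\<close> uses up every chip at \<open>v\<close>, so
  \<open>x\<close> cannot outstay it.\<close>

lemma min_sent_before:
  assumes "v \<ge> 1" "v \<in> subtree i" "level v + m < n"
    and "s < N" "site s = v" "remaining (Suc s) v = m" "t \<le> s" "x \<in> C t v"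
  shows "\<exists>r\<le>s. site r = v \<and> x \<in> C (Suc r) (child d v)"
proof (cases "x \<in> C s v")
  case True
  then have "x \<in> {lo s, mid s, hi s}" using tightD(3)[OF tight, of v m s] assms by simp
  then show ?thesis using min_sent(2)[of s] assms by auto
next
  case False
  then show ?thesis using min_leaves[of t s v] assms by (meson less_imp_le)
qed

text \<open>Tightness places the child's firing that leaves \<open>m\<close> after the firing of
  \<open>v\<close> that leaves \<open>Suc m\<close>, so \<open>x\<close> always arrives in time to
  be passed on. The walk ends on level \<open>n\<close>, whose nodes never fire.\<close>

lemma min_descends:
  assumes "v \<ge> 1" "v \<in> subtree i" "level v + Suc m = n"
    and "s < N" "site s = v" "remaining (Suc s) v = m" "t \<le> s" "x \<in> C t v"
  shows "x \<in> C N ((child d ^^ Suc m) v)"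
  using assms
proof (induction m arbitrary: v s t)
  case (0 v s t)
  then obtain r where r: "r \<le> s" "x \<in> C (Suc r) (child d v)"
    using min_sent_before[of v 0 s t] by auto
  have w: "child d v \<ge> 1" "level (child d v) = n"
    using 0 level_child[of v d] by (auto simp: child_eq)
  then have "remaining 0 (child d v) = 0"
    using firings_eq_expected[of "child d v"] by (simp add: expected_def)
  then have "remaining (Suc r) (child d v) = 0"
    using remaining_antimono[of 0 "Suc r" "child d v"] r 0 by simp
  then show ?case using stays[of "Suc r" N "child d v" x] r 0 by simp
next
  case (Suc m v s t)
  then obtain r where r: "r \<le> s" "site r = v" "x \<in> C (Suc r) (child d v)"
    using min_sent_before[of v "Suc m" s t] by auto
  have w: "child d v \<ge> 1" "child d v \<in> subtree i" "level (child d v) + Suc m = n"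
    using Suc.prems level_child[of v d] subtree_child[of v i d] by (auto simp: child_eq)
  then have "m < remaining 0 (child d v)" using remaining_ge[of "child d v"] by simp
  then obtain q where q: "q < N" "site q = child d v" "remaining (Suc q) (child d v) = m"
    by (rule obtain_firing)
  have "remaining (Suc q) v = Suc m"
    using tightD(2)[OF tight q child_ne_1] w Suc.prems by simp
  moreover have "remaining r v \<ge> Suc (Suc m)"
    using remaining_antimono[of r s v] remaining_step[of s v] r Suc.prems by simp
  ultimately have "r \<le> q" using remaining_less_imp_le[of q v r] q r Suc.prems by simp
  moreover have "r \<noteq> q" using r q Suc.prems by auto
  ultimately have "x \<in> C N ((child d ^^ Suc m) (child d v))"
    using Suc.IH[of "child d v" q "Suc r"] w q r by simp
  then show ?case by (simp add: funpow_swap1)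
qed

lemma min_arrives:
  assumes "i = 1 \<or> (\<exists>p\<ge>1. i = child (\<not> d) p)" "level i + Suc m = n"
    and x: "x \<in> subtree_chips (C N) i"
    and s: "s < N" "site s = i" "remaining (Suc s) i = m"
  shows "\<exists>t\<le>s. x \<in> C t i"
proof (cases "i = 1")
  case True
  have "x \<in> {1..2 ^ n - 1}" using x labels[of N] unfolding subtree_chips_def by blast
  then have "x \<in> C 0 i" using True by (simp add: start initial_def)
  then show ?thesis by blast
next
  case False
  then obtain p where p: "p \<ge> 1" "i = child (\<not> d) p" using assms by auto
  have ip: "parent i = p" "level i = Suc (level p)"
    using p level_child[of p] by auto
  have "1 \<notin> subtree i" using subtree_ge[of 1 i] i False by auto
  then have "x \<notin> subtree_chips (C 0) i" by (auto simp: subtree_chips_def start initial_def)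
  \<comment> \<open>Take the first firing that brings \<open>x\<close> into the subtree. It happens
    outside the subtree, hence at the parent \<open>p\<close> of \<open>i\<close>.\<close>
  then have "\<exists>k<N. (\<forall>j\<le>k. \<not> x \<in> subtree_chips (C j) i) \<and> x \<in> subtree_chips (C (Suc k)) i"
    using x by (intro ex_least_nat_less)
  then obtain t where t: "t < N" "x \<notin> subtree_chips (C t) i" "x \<in> subtree_chips (C (Suc t)) i"
    by auto
  then obtain w where w: "w \<in> subtree i" "x \<in> C (Suc t) w" by (auto simp: subtree_chips_def)
  have st: "site t \<notin> subtree i" if "x \<in> C t (site t)"
    using that t by (auto simp: subtree_chips_def)
  have fired: "mid t \<in> C t (site t)" "sent e t \<in> C t (site t)" for e
    using chips_in[of t] t by (auto simp: sent_def)
  have "\<not> (w = parent (site t) \<and> x = mid t)"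
  proof
    assume a: "w = parent (site t) \<and> x = mid t"
    show False
    proof (cases "site t = 1")
      case True
      then show False using a w st fired by (simp add: parent_def)
    next
      case False
      then obtain e where "site t = child e (parent (site t))"
        using child_cases[of "site t"] site_ge[of t] t by auto
      then show False using subtree_child[of w i e] a w st fired by auto
    qed
  qed
  then obtain e where e: "w = child e (site t)" "x = sent e t"
    using in_step_iff[of t x w] w t by (auto simp: subtree_chips_def)
  then have "w = i" using child_in_subtreeD[of e "site t" i] w st fired by auto
  then have site: "site t = p" and "e = (\<not> d)"
    using e p by (simp_all add: child_eq_iff)
  have xi: "x \<in> C (Suc t) i" using w \<open>w = i\<close> by simp
  show ?thesis
  proof (cases "t < s")
    case True
    then show ?thesis using xi by (intro exI[of _ "Suc t"]) auto
  next
    case False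
    \<comment> \<open>Suppose \<open>x\<close> comes too late. Tightness puts the firing
      \<open>r\<close> of \<open>i\<close> that leaves \<open>k\<close> before \<open>t\<close>,
      with no firing of \<open>p\<close> in between, so \<open>mid r\<close> waits at
      \<open>p\<close> until \<open>t\<close>.\<close>
    define k where "k = remaining (Suc t) p"
    have "s \<noteq> t" using s site ip i p by auto
    then have "s < t" using False by simp
    have "remaining (Suc s) p = Suc m"
      using tightD(2)[OF tight s(1-3)] i assms(2) \<open>i \<noteq> 1\<close> ip by simp
    moreover have rt: "remaining t p = Suc k" using remaining_step[of t p] site t by (simp add: k_def)
    ultimately have km: "k \<le> m" using remaining_antimono[of "Suc s" t p] \<open>s < t\<close> t by simp
    then have "k < remaining 0 i" using remaining_ge[of i] i assms(2) by simp
    then obtain r where r: "r < N" "site r = i" "remaining (Suc r) i = k" by (rule obtain_firing)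
    have rp: "remaining (Suc r) p = Suc k"
      using tightD(2)[OF tight r] i assms(2) km \<open>i \<noteq> 1\<close> ip by simp
    then have "r < t"
      using remaining_antimono[of "Suc t" "Suc r" p] r t by (fastforce simp: k_def)
    have "mid r \<in> C (Suc r) p" using in_step_iff[of r] r ip by auto
    moreover have "firings (Suc r) t p = 0"
      using firings_split[of "Suc r" t N p] rp rt \<open>r < t\<close> t by simp
    ultimately have "mid r \<in> C t p" using stays[of "Suc r" t p] \<open>r < t\<close> t by simp
    then have "mid r \<in> {lo t, mid t, hi t}"
      using tightD(3)[OF tight t(1) site k_def[symmetric]] p ip assms(2) km by simp
    \<comment> \<open>Going to the side opposite to \<open>d\<close>, \<open>x\<close> is the
      largest of the three chips in the orientation. Yet \<open>sent d r\<close>, which is below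
      \<open>mid r\<close>, was in the subtree, so \<open>x\<close> would not be minimal.\<close>
    then have "orient d * mid r \<le> orient d * x"
      using orient_sent[of t d] t fired_chips_eq[of t d] e \<open>e = (\<not> d)\<close> by auto
    moreover have "sent d r \<in> subtree_chips (C r) i"
      using chips_in[of r] r subtree.root[of i] by (auto simp: subtree_chips_def sent_def)
    then have "orient d * x \<le> orient d * sent d r" using minimal less_imp_le[OF r(1)] by blast
    ultimately show ?thesis using orient_sent(1)[of r d] r by simp
  qed
qed

end

lemma funpow_child_in_subtree: "(child d ^^ m) i \<in> subtree i"
  by (induction m) (auto intro: subtree.root subtree_child)

text \<open>A child on side \<open>d\<close> shares its straight descendant with its parent, and a
  chip extreme in the larger subtree is extreme in the smaller one. Only the root and children on
  the other side need the timing argument.\<close>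

lemma extreme_chip:
  assumes "i \<ge> 1" "level i < n"
  shows "\<exists>x. C N ((child d ^^ (n - level i)) i) = {x} \<and>
    (\<forall>y\<in>subtree_chips (C N) i. orient d * x \<le> orient d * y)"
  using assms
proof (induction i rule: less_induct)
  case (less i)
  show ?case
  proof (cases "\<exists>p\<ge>1. i = child d p")
    case True
    then obtain p where p: "p \<ge> 1" "i = child d p" by blast
    have lev: "level i = Suc (level p)" using p level_child by simp
    have "n - level p = Suc (n - level i)" using lev less.prems by simp
    have "p < i" using p by (simp add: child_eq)
    obtain x where x: "C N ((child d ^^ (n - level p)) p) = {x}"
      "\<forall>y\<in>subtree_chips (C N) p. orient d * x \<le> orient d * y"
      using less.IH[OF \<open>p < i\<close> p(1)] less.prems lev by auto
    have "(child d ^^ (n - level p)) p = (child d ^^ (n - level i)) i"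
      using p \<open>n - level p = Suc (n - level i)\<close> by (simp add: funpow_swap1)
    moreover have "subtree_chips (C N) i \<subseteq> subtree_chips (C N) p"
      using p subtree_trans[of _ i p] subtree_child[OF subtree.root, of d p]
      by (auto simp: subtree_chips_def)
    ultimately show ?thesis using x by auto
  next
    case False
    define S where "S = subtree_chips (C N) i"
    define v where "v = (child d ^^ (n - level i)) i"
    have "S \<subseteq> {1..2 ^ n - 1}" using labels[of N] by (auto simp: S_def subtree_chips_def)
    then have "finite S" using finite_subset by blast
    moreover have "card (C N i) = 1" using final_card[of i] less.prems by simp
    then have "S \<noteq> {}" using subtree.root[of i] by (auto simp: S_def subtree_chips_def card_1_singleton_iff)
    ultimately have "Min ((*) (orient d) ` S) \<in> (*) (orient d) ` S" by (intro Min_in) auto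
    then obtain x where x: "x \<in> S" "orient d * x = Min ((*) (orient d) ` S)" by auto
    have xmin: "orient d * x \<le> orient d * z" if "z \<in> S" for z
      unfolding x(2) using that \<open>finite S\<close> by (intro Min_le) auto
    \<comment> \<open>Extremality at the end carries back to all times, including those when
      \<open>x\<close> is still outside the subtree.\<close>
    then have minimal: "\<forall>t\<le>N. \<forall>y\<in>subtree_chips (C t) i. orient d * x \<le> orient d * y"
      using final_min_le[of _ i d x] less.prems by (auto simp: S_def)
    have right: "i = 1 \<or> (\<exists>p\<ge>1. i = child (\<not> d) p)"
    proof (cases "i = 1")
      case False
      then obtain e where e: "i = child e (parent i)" "parent i \<ge> 1"
        using child_cases[of i] less.prems(1) by auto
      then have "e = (\<not> d)" using \<open>\<not> (\<exists>p\<ge>1. i = child d p)\<close> by (cases e; cases d) auto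
      then show ?thesis using e by blast
    qed simp
    obtain m where m: "level i + Suc m = n" using less.prems(2) less_iff_Suc_add by auto
    then have "m < remaining 0 i" using remaining_ge[of i] less.prems by simp
    then obtain s where s: "s < N" "site s = i" "remaining (Suc s) i = m" by (rule obtain_firing)
    obtain t where "t \<le> s" "x \<in> C t i"
      using min_arrives[OF less.prems(1) minimal right m _ s] x by (auto simp: S_def)
    then have "x \<in> C N ((child d ^^ Suc m) i)"
      using min_descends[OF less.prems(1) minimal less.prems(1) subtree.root m s] by auto
    moreover have "n - level i = Suc m" using m by simp
    ultimately have "x \<in> C N v" by (simp add: v_def)
    moreover have "v \<ge> 1"
      using subtree_ge[OF funpow_child_in_subtree, of i "n - level i" d] less.prems by (simp add: v_def)
    then have "card (C N v) \<le> 1" using final_card[of v] by simp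
    moreover have "finite (C N v)" using valid[of N] by (simp add: valid_config_def)
    ultimately have "C N v = {x}" by (auto simp: card_le_Suc0_iff_eq)
    then show ?thesis using xmin by (auto simp: S_def v_def)
  qed
qed

end

section \<open>Straight descendants, extraction of a run, and the conclusion\<close>

lemma funpow_child_False: "(child False ^^ m) i = 2 ^ m * i"
  by (induction m) (auto simp: child_eq)

text \<open>After adding 1, the map v -> 2 v + 1 becomes doubling.\<close>

lemma funpow_child_True: "(child True ^^ m) i = 2 ^ m * (i + 1) - 1"
proof -
  have "(child True ^^ m) i + 1 = 2 ^ m * (i + 1)"
    by (induction m) (auto simp: child_eq)
  then show ?thesis by simp
qed

lemma reachable_run:
  assumes "n \<ge> 1" "reachable (initial n) D" "terminal D"
  obtains N C site lo mid hi where "stabilizing_run n N C site lo mid hi" "C N = D"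
proof -
  have "fires\<^sup>*\<^sup>* (initial n) D"
    using assms(2) by (simp add: reachable_def)
  then obtain N where "(fires ^^ N) (initial n) D"
    using rtranclp_imp_relpowp[of fires "initial n" D] by blast
  then obtain C where C: "C 0 = initial n" "C N = D" "\<forall>t<N. fires (C t) (C (Suc t))"
    by (auto simp: relpowp_fun_conv)
  \<comment> \<open>The condition \<open>t < N\<close> sits inside the quantifiers so that the
    choice functions are total.\<close>
  have "\<forall>t. \<exists>v a b c. t < N \<longrightarrow> v \<ge> 1 \<and> {a, b, c} \<subseteq> C t v \<and> a < b \<and> b < c
      \<and> C (Suc t) = fire (C t) v a b c"
  proof
    fix t
    show "\<exists>v a b c. t < N \<longrightarrow> v \<ge> 1 \<and> {a, b, c} \<subseteq> C t v \<and> a < b \<and> b < c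
      \<and> C (Suc t) = fire (C t) v a b c"
    proof (cases "t < N")
      case True
      then have "fires (C t) (C (Suc t))" using C(3) by blast
      then show ?thesis by cases blast
    qed simp
  qed
  then obtain site lo mid hi where
    "\<forall>t. t < N \<longrightarrow> site t \<ge> 1 \<and> {lo t, mid t, hi t} \<subseteq> C t (site t) \<and> lo t < mid t \<and> mid t < hi t
      \<and> C (Suc t) = fire (C t) (site t) (lo t) (mid t) (hi t)"
    by metis
  then have "stabilizing_run n N C site lo mid hi"
    using C assms by unfold_locales auto
  then show ?thesis using that C(2) by blast
qed

theorem theorem1p3:
  fixes n :: nat and C :: config
  assumes "n \<ge> 1"
    and "reachable (initial n) C"
    and "terminal C"
  shows "(\<forall>v. 1 \<le> v \<and> level v \<le> n \<longrightarrow> card (C v) = 1)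
    \<and> (\<forall>v. \<not> (1 \<le> v \<and> level v \<le> n) \<longrightarrow> C v = {})
    \<and> (\<forall>i k. 1 \<le> i \<and> level i = k \<and> 1 \<le> k \<and> k \<le> n - 1 \<longrightarrow>
         (\<exists>x. C (2 ^ (n - k) * i) = {x} \<and> x \<in> subtree_chips C i
               \<and> (\<forall>y\<in>subtree_chips C i. x \<le> y))
       \<and> (\<exists>x. C (2 ^ (n - k) * (i + 1) - 1) = {x} \<and> x \<in> subtree_chips C i
               \<and> (\<forall>y\<in>subtree_chips C i. y \<le> x)))"
proof -
  obtain N D site lo mid hi where "stabilizing_run n N D site lo mid hi" and DN: "D N = C"
    using reachable_run assms by blast
  then interpret stabilizing_run n N D site lo mid hi by simp
  have card: "card (C v) = of_bool (level v \<le> n)" if "v \<ge> 1" for v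
    using final_card[OF that] DN by simp
  have valid_C: "valid_config C" using valid[of N] DN by simp
  have empty: "C v = {}" if "\<not> (1 \<le> v \<and> level v \<le> n)" for v
  \<comment> \<open>\<open>terminal\<close> does not constrain node 0; the invariant does.\<close>
  proof (cases "v = 0")
    case True
    then show ?thesis using valid_C by (simp add: valid_config_def)
  next
    case False
    then have "card (C v) = 0" using card[of v] that by simp
    then show ?thesis using valid_C by (simp add: valid_config_def)
  qed
  have extreme: "\<exists>x. C ((child d ^^ (n - level i)) i) = {x} \<and> x \<in> subtree_chips C i \<and>
      (\<forall>y\<in>subtree_chips C i. orient d * x \<le> orient d * y)"
    if "i \<ge> 1" "level i \<le> n - 1" for i d
  proof -
    have "level i < n" using that assms(1) by linarith
    then obtain x where x: "C ((child d ^^ (n - level i)) i) = {x}"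
      "\<forall>y\<in>subtree_chips C i. orient d * x \<le> orient d * y"
      using extreme_chip[of i d] \<open>i \<ge> 1\<close> DN by auto
    then have "x \<in> subtree_chips C i"
      using funpow_child_in_subtree[where d = d and m = "n - level i" and i = i]
      unfolding subtree_chips_def by blast
    then show ?thesis using x by blast
  qed
  show ?thesis
    using card empty extreme[of _ False] extreme[of _ True]
    by (simp add: funpow_child_False funpow_child_True orient_def)
qed

end
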